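(* Let $\alpha=(b_{0,0},b_{0,1},b_{1,1},b_{1,2})\in\mathbb{C}^4$ and $\alpha'=(b_{0,0}',b_{0,1}',b_{1,1}',b_{1,2}')\in\mathbb{C}^4$. The algebras $L(\alpha)$ and $L(\alpha')$ from $CE(\mu_4)$ are isomorphic if and only if there exist $A_0,A_1,B_1\in\mathbb{C}$ with $A_0B_1\neq 0$ such that $$b_{0,0}'=\frac{A_0^2b_{0,0}+A_0A_1b_{0,1}+A_1^2b_{1,1}}{A_0^{3}B_1},\quad b_{1,1}'=\frac{B_1b_{1,1}}{A_0^{3}},\quad b_{0,1}'=\frac{A_0b_{0,1}+2A_1b_{1,1}}{A_0^{3}},\quad b_{1,2}'=\frac{B_1b_{1,2}}{A_0^2}.$$
   Context: A Leibniz algebra over $\mathbb{C}$ is a complex vector space with a bilinear bracket satisfying $[x,[y,z]]=[[x,y],z]-[[x,z],y]$. $CE(\mu_4)$ (one-dimensional Leibniz central extensions of the 4-dimensional naturally graded filiform Lie algebra $\mu_4$) is the class of the 5-dimensional complex Leibniz algebras $L(\alpha)$, $\alpha=(b_{0,0},b_{0,1},b_{1,1},b_{1,2})\in\mathbb{C}^4$, with basis $e_0,\dots,e_4$ and brackets $[e_i,e_0]=e_{i+1}$ ($1\le i\le 3$), $[e_0,e_i]=-e_{i+1}$ ($2\le i\le 3$), $[e_0,e_0]=b_{0,0}e_4$, $[e_0,e_1]=-e_2+b_{0,1}e_4$, $[e_1,e_1]=b_{1,1}e_4$, $[e_1,e_2]=-[e_2,e_1]=b_{1,2}e_4$, all other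 brackets of basis vectors being zero. Isomorphic means isomorphic as Leibniz algebras. *)

theory Defs
  imports "HOL-Analysis.Analysis"
begin

locale leibniz_algebra = vector_space scale
  for scale :: "complex \<Rightarrow> 'a::ab_group_add \<Rightarrow> 'a" +
  fixes bracket :: "'a \<Rightarrow> 'a \<Rightarrow> 'a"
  assumes bracket_add_left: "bracket (x + y) z = bracket x z + bracket y z"
    and bracket_add_right: "bracket x (y + z) = bracket x y + bracket x z"
    and bracket_scale_left: "bracket (scale c x) y = scale c (bracket x y)"
    and bracket_scale_right: "bracket x (scale c y) = scale c (bracket x y)"
    and leibniz_identity:
      "bracket x (bracket y z) = bracket (bracket x y) z - bracket (bracket x z) y"

locale leibniz_isomorphism =
  dom: leibniz_algebra scale1 bracket1 +
  cod: leibniz_algebra scale2 bracket2 +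
  Vector_Spaces.linear scale1 scale2 f
  for scale1 :: "complex \<Rightarrow> 'a::ab_group_add \<Rightarrow> 'a" and bracket1
    and scale2 :: "complex \<Rightarrow> 'b::ab_group_add \<Rightarrow> 'b" and bracket2
    and f :: "'a \<Rightarrow> 'b" +
  assumes bijective: "bij f"
    and map_bracket: "f (bracket1 x y) = bracket2 (f x) (f y)"

definition leibniz_isomorphic ::
    "(complex \<Rightarrow> 'a::ab_group_add \<Rightarrow> 'a) \<Rightarrow> ('a \<Rightarrow> 'a \<Rightarrow> 'a) \<Rightarrow>
     (complex \<Rightarrow> 'b::ab_group_add \<Rightarrow> 'b) \<Rightarrow> ('b \<Rightarrow> 'b \<Rightarrow> 'b) \<Rightarrow> bool" where
  "leibniz_isomorphic scale1 bracket1 scale2 bracket2 \<longleftrightarrow>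
     (\<exists>f. leibniz_isomorphism scale1 bracket1 scale2 bracket2 f)"

(* The five elements of the index type 5 are 0, 1, 2, 3, 4, with arithmetic modulo 5; no index
   computation below wraps around. *)

definition e :: "5 \<Rightarrow> complex ^ 5" where
  "e i = axis i 1"

definition CE_basis_bracket ::
    "complex \<Rightarrow> complex \<Rightarrow> complex \<Rightarrow> complex \<Rightarrow> 5 \<Rightarrow> 5 \<Rightarrow> complex ^ 5" where
  "CE_basis_bracket b00 b01 b11 b12 i j =
     (if i \<in> {1, 2, 3} \<and> j = 0 then e (i + 1)
      else if i = 0 \<and> j \<in> {2, 3} then - e (j + 1)
      else if i = 0 \<and> j = 0 then b00 *s e 4
      else if i = 0 \<and> j = 1 then - e 2 + b01 *s e 4
      else if i = 1 \<and> j = 1 then b11 *s e 4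
      else if i = 1 \<and> j = 2 then b12 *s e 4
      else if i = 2 \<and> j = 1 then - (b12 *s e 4)
      else 0)"

definition CE_bracket ::
    "complex \<Rightarrow> complex \<Rightarrow> complex \<Rightarrow> complex \<Rightarrow> complex ^ 5 \<Rightarrow> complex ^ 5 \<Rightarrow> complex ^ 5" where
  "CE_bracket b00 b01 b11 b12 x y =
     (\<Sum>i\<in>UNIV. \<Sum>j\<in>UNIV. (x $ i * y $ j) *s CE_basis_bracket b00 b01 b11 b12 i j)"

lemma exhaust_5: "i = 0 \<or> i = 1 \<or> i = 2 \<or> i = 3 \<or> i = (4::5)"
proof (induct i)
  case (of_int z)
  then have "z = 0 \<or> z = 1 \<or> z = 2 \<or> z = 3 \<or> z = 4" by simp linarith
  then show ?case by auto
qed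

lemma UNIV_5: "(UNIV :: 5 set) = {0, 1, 2, 3, 4}"
  using exhaust_5 by auto

lemma sum_5: "sum f (UNIV :: 5 set) = f 0 + f 1 + f 2 + f 3 + f 4"
  unfolding UNIV_5 by (simp add: ac_simps)

lemma forall_5: "(\<forall>i::5. P i) \<longleftrightarrow> P 0 \<and> P 1 \<and> P 2 \<and> P 3 \<and> P 4"
  by (metis exhaust_5)

lemma CE_bracket_e: "CE_bracket b00 b01 b11 b12 (e i) (e j) = CE_basis_bracket b00 b01 b11 b12 i j"
proof -
  let ?c = "CE_basis_bracket b00 b01 b11 b12"
  have "CE_bracket b00 b01 b11 b12 (e i) (e j) =
      (\<Sum>k\<in>UNIV. \<Sum>l\<in>UNIV. if l = j then (if k = i then ?c k l else 0) else 0)"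
    unfolding CE_bracket_def
    by (intro sum.cong refl) (simp add: e_def axis_def)
  also have "\<dots> = ?c i j"
    by simp
  finally show ?thesis .
qed

lemma CE_bracket_nth:
  "CE_bracket b00 b01 b11 b12 x y $ 0 = 0"
  "CE_bracket b00 b01 b11 b12 x y $ 1 = 0"
  "CE_bracket b00 b01 b11 b12 x y $ 2 = x $ 1 * y $ 0 - x $ 0 * y $ 1"
  "CE_bracket b00 b01 b11 b12 x y $ 3 = x $ 2 * y $ 0 - x $ 0 * y $ 2"
  "CE_bracket b00 b01 b11 b12 x y $ 4 =
     x $ 3 * y $ 0 - x $ 0 * y $ 3 + b00 * (x $ 0 * y $ 0) + b01 * (x $ 0 * y $ 1)
     + b11 * (x $ 1 * y $ 1) + b12 * (x $ 1 * y $ 2 - x $ 2 * y $ 1)"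
  by (simp_all add: CE_bracket_def CE_basis_bracket_def sum_5 e_def axis_def algebra_simps)

lemma leibniz_algebra_CE: "leibniz_algebra (*s) (CE_bracket b00 b01 b11 b12)"
  by unfold_locales
    (simp_all add: vec_eq_iff forall_5 CE_bracket_nth algebra_simps)

end

theory Submission
  imports Defs
begin

text \<open>An isomorphism \<open>g : L(\<alpha>') \<rightarrow> L(\<alpha>)\<close> is determined by \<open>a = g e\<^sub>0\<close> and \<open>b = g e\<^sub>1\<close>, since
  \<open>e\<^sub>2, e\<^sub>3, e\<^sub>4\<close> arise from \<open>e\<^sub>1\<close> by right multiplication with \<open>e\<^sub>0\<close>. Writing \<open>D = a\<^sub>0b\<^sub>1 - a\<^sub>1b\<^sub>0\<close>, one
  finds \<open>g e\<^sub>4 = a\<^sub>0\<^sup>2D e\<^sub>4\<close>, so \<open>a\<^sub>0\<close> and \<open>D\<close> are nonzero, and the \<open>e\<^sub>3\<close>-coordinate of \<open>g [e\<^sub>1, e\<^sub>2]\<close> is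
  \<open>-b\<^sub>0D\<close>, which forces \<open>b\<^sub>0 = 0\<close>. The \<open>e\<^sub>4\<close>-coordinates of
  the images of \<open>[e\<^sub>0, e\<^sub>0]\<close>, \<open>[e\<^sub>1, e\<^sub>1]\<close>, \<open>[e\<^sub>0, e\<^sub>1]\<close>, \<open>[e\<^sub>1, e\<^sub>2]\<close> are then the four equations
  for \<open>A\<^sub>0 = a\<^sub>0\<close>, \<open>A\<^sub>1 = a\<^sub>1\<close>, \<open>B\<^sub>1 = b\<^sub>1\<close>. Conversely,
  \<open>e\<^sub>0 \<mapsto> A\<^sub>0e\<^sub>0 + A\<^sub>1e\<^sub>1\<close>, \<open>e\<^sub>1 \<mapsto> B\<^sub>1e\<^sub>1\<close> extends to an isomorphism.\<close>

lemma leibniz_isomorphism_inv: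
  assumes "leibniz_isomorphism scale1 bracket1 scale2 bracket2 f"
  shows "leibniz_isomorphism scale2 bracket2 scale1 bracket1 (inv f)"
proof -
  interpret leibniz_isomorphism scale1 bracket1 scale2 bracket2 f by fact
  have inj: "inj f" and surj: "surj f"
    using bijective by (auto simp: bij_def)
  note f_inv = surj_f_inv_f [OF surj]
  have inv_eq: "inv f y = x" if "f x = y" for x y
    using inj that by (auto simp: inv_f_f)
  show ?thesis
  proof (intro leibniz_isomorphism.intro leibniz_isomorphism_axioms.intro)
    show "Vector_Spaces.linear scale2 scale1 (inv f)"
      by unfold_locales (auto intro!: inv_eq simp: add scale f_inv)
    show "inv f (bracket2 x y) = bracket1 (inv f x) (inv f y)" for x y
      by (intro inv_eq) (simp add: map_bracket f_inv)
  qed (use bijective in \<open>auto intro: bij_imp_bij_inv dom.leibniz_algebra_axioms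
        cod.leibniz_algebra_axioms\<close>)
qed

text \<open>This allows reversing the isomorphism: the primed parameters are read off from a map
  into the unprimed algebra.\<close>

lemma leibniz_isomorphic_sym:
  "leibniz_isomorphic scale1 bracket1 scale2 bracket2 \<longleftrightarrow>
   leibniz_isomorphic scale2 bracket2 scale1 bracket1"
  unfolding leibniz_isomorphic_def by (metis leibniz_isomorphism_inv)

lemma CE_isomorphism_parameters:
  assumes "leibniz_isomorphism (*s) (CE_bracket b00' b01' b11' b12')
             (*s) (CE_bracket b00 b01 b11 b12) g"
  defines "a \<equiv> g (e 0)" and "b \<equiv> g (e 1)"
  shows "a $ 0 * b $ 1 \<noteq> 0"
    and "b00' = ((a $ 0)\<^sup>2 * b00 + a $ 0 * a $ 1 * b01 + (a $ 1)\<^sup>2 * b11) / (a $ 0 ^ 3 * b $ 1)"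
    and "b11' = b $ 1 * b11 / a $ 0 ^ 3"
    and "b01' = (a $ 0 * b01 + 2 * a $ 1 * b11) / a $ 0 ^ 3"
    and "b12' = b $ 1 * b12 / (a $ 0)\<^sup>2"
proof -
  interpret leibniz_isomorphism "(*s)" "CE_bracket b00' b01' b11' b12'"
    "(*s)" "CE_bracket b00 b01 b11 b12" g by fact
  let ?B = "CE_bracket b00 b01 b11 b12"
  have g_basis: "g (CE_basis_bracket b00' b01' b11' b12' i j) = ?B (g (e i)) (g (e j))" for i j
    using map_bracket [of "e i" "e j"] by (simp add: CE_bracket_e)
  have g2: "g (e 2) = ?B b a" and g3: "g (e 3) = ?B (g (e 2)) a" and g4: "g (e 4) = ?B (g (e 3)) a"
    using g_basis [of 1 0] g_basis [of 2 0] g_basis [of 3 0]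
    by (simp_all add: CE_basis_bracket_def a_def b_def)
  \<comment> \<open>\<open>D\<close> is the determinant of the map induced by \<open>g\<close>
    modulo the span of \<open>e 2\<close>, \<open>e 3\<close>, \<open>e 4\<close>.\<close>
  define D where "D = b $ 1 * a $ 0 - b $ 0 * a $ 1"
  have g4_nth: "g (e 4) $ 0 = 0" "g (e 4) $ 1 = 0" "g (e 4) $ 2 = 0" "g (e 4) $ 3 = 0"
    "g (e 4) $ 4 = D * (a $ 0)\<^sup>2"
    by (simp_all add: g4 g3 g2 CE_bracket_nth D_def power2_eq_square)
  have "e 4 \<noteq> 0"
    by (simp add: e_def)
  then have "g (e 4) \<noteq> 0"
    using bijective zero by (metis bij_is_inj injD)
  then have nz: "D \<noteq> 0" "a $ 0 \<noteq> 0"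
    using g4_nth by (auto simp: vec_eq_iff forall_5)
  have "?B b (g (e 2)) = b12' *s g (e 4)"
    using g_basis [of 1 2] by (simp add: CE_basis_bracket_def b_def scale)
  then have *: "?B b (g (e 2)) $ k = b12' * g (e 4) $ k" for k
    by simp
  have "b $ 0 * D = 0"
    using * [of 3] by (simp add: g4_nth g2 CE_bracket_nth D_def)
  with nz have b0: "b $ 0 = 0" by simp
  with nz show nz': "a $ 0 * b $ 1 \<noteq> 0"
    by (auto simp: D_def)
  have D: "D = a $ 0 * b $ 1"
    by (simp add: D_def b0)
  show "b12' = b $ 1 * b12 / (a $ 0)\<^sup>2"
    using * [of 4] nz' by (simp add: g4_nth g2 CE_bracket_nth D b0 field_simps)
  have "?B b b = b11' *s g (e 4)"
    using g_basis [of 1 1] by (simp add: CE_basis_bracket_def b_def scale)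
  then have "?B b b $ 4 = b11' * g (e 4) $ 4"
    by simp
  then show "b11' = b $ 1 * b11 / a $ 0 ^ 3"
    using nz' by (simp add: g4_nth CE_bracket_nth D b0 field_simps power2_eq_square power3_eq_cube)
  have "?B a b = - g (e 2) + b01' *s g (e 4)"
    using g_basis [of 0 1] by (simp add: CE_basis_bracket_def a_def b_def scale add neg diff)
  then have "?B a b $ 4 = - g (e 2) $ 4 + b01' * g (e 4) $ 4"
    by simp
  \<comment> \<open>Moving \<open>g (e 2) $ 4\<close>, a coordinate of \<open>?B b a\<close>, to the
    left cancels the antisymmetric terms and doubles the \<open>b11\<close> term; hence the factor
    2.\<close>
  then have "b $ 1 * (a $ 0 * b01 + 2 * a $ 1 * b11) = b $ 1 * (b01' * a $ 0 ^ 3)"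
    by (simp add: g4_nth g2 CE_bracket_nth D b0 power2_eq_square power3_eq_cube algebra_simps)
  then have "a $ 0 * b01 + 2 * a $ 1 * b11 = b01' * a $ 0 ^ 3"
    using nz' by (simp only: mult_cancel_left) simp
  then show "b01' = (a $ 0 * b01 + 2 * a $ 1 * b11) / a $ 0 ^ 3"
    using nz' by simp
  have "?B a a = b00' *s g (e 4)"
    using g_basis [of 0 0] by (simp add: CE_basis_bracket_def a_def scale)
  then have "?B a a $ 4 = b00' * g (e 4) $ 4"
    by simp
  then show "b00' = ((a $ 0)\<^sup>2 * b00 + a $ 0 * a $ 1 * b01 + (a $ 1)\<^sup>2 * b11) /
      (a $ 0 ^ 3 * b $ 1)"
    using nz' by (simp add: g4_nth CE_bracket_nth D field_simps power2_eq_square power3_eq_cube)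
qed

text \<open>With \<open>a = A0 *s e 0 + A1 *s e 1\<close>, the images of \<open>e 2\<close>,
  \<open>e 3\<close>, \<open>e 4\<close> are iterated right products of \<open>B1 *s e 1\<close> by
  \<open>a\<close> in the unprimed algebra. The \<open>b11\<close> and \<open>b12\<close> terms stem
  from \<open>[e 1, e 1]\<close> and \<open>[e 2, e 1]\<close>.\<close>

definition CE_map ::
    "complex \<Rightarrow> complex \<Rightarrow> complex \<Rightarrow> complex \<Rightarrow> complex \<Rightarrow> complex ^ 5 \<Rightarrow> complex ^ 5" where
  "CE_map b11 b12 A0 A1 B1 x = (\<chi> i.
     if i = 0 then A0 * x $ 0
     else if i = 1 then A1 * x $ 0 + B1 * x $ 1
     else if i = 2 then A0 * B1 * x $ 2
     else if i = 3 then A0\<^sup>2 * B1 * x $ 3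
     else A1 * B1 * b11 * x $ 2 - A0 * A1 * B1 * b12 * x $ 3 + A0 ^ 3 * B1 * x $ 4)"

lemma CE_map_nth:
  "CE_map b11 b12 A0 A1 B1 x $ 0 = A0 * x $ 0"
  "CE_map b11 b12 A0 A1 B1 x $ 1 = A1 * x $ 0 + B1 * x $ 1"
  "CE_map b11 b12 A0 A1 B1 x $ 2 = A0 * B1 * x $ 2"
  "CE_map b11 b12 A0 A1 B1 x $ 3 = A0\<^sup>2 * B1 * x $ 3"
  "CE_map b11 b12 A0 A1 B1 x $ 4 =
     A1 * B1 * b11 * x $ 2 - A0 * A1 * B1 * b12 * x $ 3 + A0 ^ 3 * B1 * x $ 4"
  by (simp_all add: CE_map_def)

lemma linear_CE_map: "Vector_Spaces.linear (*s) (*s) (CE_map b11 b12 A0 A1 B1)"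
  by unfold_locales (simp_all add: vec_eq_iff forall_5 CE_map_nth algebra_simps)

text \<open>The matrix is lower triangular with diagonal \<open>A0\<close>, \<open>B1\<close>,
  \<open>A0 * B1\<close>, \<open>A0\<^sup>2 * B1\<close>, \<open>A0 ^ 3 * B1\<close>.\<close>

lemma bij_CE_map:
  assumes "A0 * B1 \<noteq> 0"
  shows "bij (CE_map b11 b12 A0 A1 B1)"
proof -
  have "inj (CE_map b11 b12 A0 A1 B1)"
    using assms by (auto intro!: injI simp: vec_eq_iff forall_5 CE_map_nth)
  then show ?thesis
    using vec.linear_inj_imp_surj [OF linear_CE_map] by (simp add: bij_def)
qed

lemma leibniz_isomorphism_CE_map:
  assumes nz: "A0 * B1 \<noteq> 0"
    and b00': "b00' = (A0\<^sup>2 * b00 + A0 * A1 * b01 + A1\<^sup>2 * b11) / (A0 ^ 3 * B1)"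
    and b11': "b11' = B1 * b11 / A0 ^ 3"
    and b01': "b01' = (A0 * b01 + 2 * A1 * b11) / A0 ^ 3"
    and b12': "b12' = B1 * b12 / A0\<^sup>2"
  shows "leibniz_isomorphism (*s) (CE_bracket b00' b01' b11' b12')
           (*s) (CE_bracket b00 b01 b11 b12) (CE_map b11 b12 A0 A1 B1)"
proof (intro leibniz_isomorphism.intro leibniz_isomorphism_axioms.intro
    leibniz_algebra_CE linear_CE_map bij_CE_map nz)
  fix x y
  have eqs: "A0 ^ 3 * B1 * b00' = A0\<^sup>2 * b00 + A0 * A1 * b01 + A1\<^sup>2 * b11"
    "A0 ^ 3 * b11' = B1 * b11"
    "A0 ^ 3 * b01' = A0 * b01 + 2 * A1 * b11"
    "A0\<^sup>2 * b12' = B1 * b12"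
    using nz by (simp_all add: b00' b11' b01' b12')
  let ?L = "CE_map b11 b12 A0 A1 B1 (CE_bracket b00' b01' b11' b12' x y)"
  let ?R = "CE_bracket b00 b01 b11 b12 (CE_map b11 b12 A0 A1 B1 x) (CE_map b11 b12 A0 A1 B1 y)"
  \<comment> \<open>The grouping makes primed parameters occur only in the left-hand sides of
    \<open>eqs\<close>, so rewriting leaves a polynomial identity.\<close>
  have "?L $ 4 = A1 * B1 * b11 * (x $ 1 * y $ 0 - x $ 0 * y $ 1)
      - A0 * A1 * B1 * b12 * (x $ 2 * y $ 0 - x $ 0 * y $ 2)
      + A0 ^ 3 * B1 * (x $ 3 * y $ 0 - x $ 0 * y $ 3)
      + (A0 ^ 3 * B1 * b00') * (x $ 0 * y $ 0) + B1 * (A0 ^ 3 * b01') * (x $ 0 * y $ 1)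
      + B1 * (A0 ^ 3 * b11') * (x $ 1 * y $ 1)
      + A0 * B1 * (A0\<^sup>2 * b12') * (x $ 1 * y $ 2 - x $ 2 * y $ 1)"
    unfolding CE_map_nth CE_bracket_nth by algebra
  also have "\<dots> = ?R $ 4"
    unfolding eqs CE_map_nth CE_bracket_nth by algebra
  finally show "?L = ?R"
    by (simp add: vec_eq_iff forall_5 CE_map_nth CE_bracket_nth algebra_simps power2_eq_square)
qed

theorem theorem3p1:
  fixes b00 b01 b11 b12 b00' b01' b11' b12' :: complex
  shows "leibniz_isomorphic (*s) (CE_bracket b00 b01 b11 b12)
           (*s) (CE_bracket b00' b01' b11' b12') \<longleftrightarrow>
         (\<exists>A0 A1 B1 :: complex. A0 * B1 \<noteq> 0 \<and>
            b00' = (A0\<^sup>2 * b00 + A0 * A1 * b01 + A1\<^sup>2 * b11) / (A0 ^ 3 * B1) \<and>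
            b11' = B1 * b11 / A0 ^ 3 \<and>
            b01' = (A0 * b01 + 2 * A1 * b11) / A0 ^ 3 \<and>
            b12' = B1 * b12 / A0\<^sup>2)"
  (is "_ \<longleftrightarrow> ?R")
proof -
  have "leibniz_isomorphic (*s) (CE_bracket b00' b01' b11' b12')
          (*s) (CE_bracket b00 b01 b11 b12) \<longleftrightarrow> ?R"
    unfolding leibniz_isomorphic_def
    using CE_isomorphism_parameters leibniz_isomorphism_CE_map by meson
  then show ?thesis
    by (subst leibniz_isomorphic_sym)
qed

end
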